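(* A map $J^{k-1}_f(\mathbb{R};Gr(n,\mathbb{R}^{kn}))\to\mathfrak{gl}(kn)$ is equivariant with respect to the $GL(kn)$-action if and only if it is of the form $$a_0I+a_1F+\frac{a_2F^2}{2}+\cdots+\frac{a_{k-1}F^{k-1}}{(k-1)!},$$ where $I$ is the identity matrix, $a_0,\dots,a_{k-1}$ are real numbers, and $$F=\mathbf{A}\left(\begin{array}{cccccc}0&I&0&\cdots&0&0\\0&0&2I&\cdots&0&0\\ \vdots&\vdots&\vdots& &\vdots&\vdots\\0&0&0&\cdots&(k-2)I&0\\0&0&0&\cdots&0&(k-1)I\\0&0&0&\cdots&0&0\end{array}\right)\mathbf{A}^{-1},\qquad \mathbf{A}=(A|\dot A|\cdots|A^{(k-1)}),$$ for the jet represented by $(A,\dot A,\dots,A^{(k-1)})$.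
   Context: Let $n\ge1$, $k\ge2$ be integers. For $r\ge k-1$, the space $J^r_f(\mathbb{R};M_{kn\times n})$ of $r$-jets of fanning frames is the set of tuples $(A,\dot A,\dots,A^{(r)})$ of real $kn\times n$ matrices such that the $kn\times kn$ matrix $(A|\dot A|\cdots|A^{(k-1)})$ is invertible. The group $J^r(\mathbb{R};GL(n))$ of $r$-jets $(X,\dot X,\dots,X^{(r)})$ of smooth curves of invertible $n\times n$ matrices (so $X\in GL(n)$ and the remaining entries are arbitrary $n\times n$ matrices) acts on the right by the Leibniz rule: the $m$-th entry of $(A,\dots,A^{(r)})\cdot(X,\dots,X^{(r)})$ is $\sum_{i=0}^m\binom{m}{i}A^{(m-i)}X^{(i)}$. The space of $r$-jets of fanning curves in the Grassmannian, $J^r_f(\mathbb{R};Gr(n,\mathbb{R}^{kn}))$, is the quotient of $J^r_f(\mathbb{R};M_{kn\times n})$ by this action. $GL(kn)$ acts on jets of frames by $T\cdot(A,\dots,A^{(r)})=(TA,\dots,TA^{(r)})$, and this induces an action on $J^r_f(\mathbb{R};Gr(n,\mathbb{R}^{kn}))$. $GL(kn)$ acts on its Lie algebra $\mathfrak{gl}(kn)$ (all $kn\times kn$ real matrices) by the adjoint action $T\cdot M=TMT^{-1}$. All blocks in the displayed matrix are $n\times n$. *)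

theory Defs
  imports "Jordan_Normal_Form.Matrix" "Jordan_Normal_Form.Gauss_Jordan_Elimination"
    "HOL-Library.FuncSet"
begin

text \<open>Sum of a family of \<open>nr \<times> nc\<close> matrices. It is given entrywise because the dimensions of a
  \<^typ>\<open>real mat\<close> are not part of its type, so that \<^const>\<open>sum\<close> is not available.\<close>

definition mat_sum :: "nat \<Rightarrow> nat \<Rightarrow> ('i \<Rightarrow> real mat) \<Rightarrow> 'i set \<Rightarrow> real mat" where
  "mat_sum nr nc M I = mat nr nc (\<lambda>(p, q). \<Sum>i\<in>I. M i $$ (p, q))"

definition GL :: "nat \<Rightarrow> real mat set" where
  "GL d = {T \<in> carrier_mat d d. invertible_mat T}"

text \<open>For an invertible matrix \<^const>\<open>mat_inverse\<close> returns \<^const>\<open>Some\<close> of the two-sided inverse.\<close>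

definition minv :: "real mat \<Rightarrow> real mat" where
  "minv T = the (mat_inverse T)"

text \<open>An \<open>r\<close>-jet is the list of length \<open>r + 1\<close> of its entries, the \<open>m\<close>-th derivative being at
  position \<open>m\<close>. In the matrix with block columns \<open>A ! 0, \<dots>, A ! (k - 1)\<close>, column \<open>q\<close> is column
  \<open>q mod n\<close> of block \<open>q div n\<close>.\<close>

definition frame_mat :: "nat \<Rightarrow> nat \<Rightarrow> real mat list \<Rightarrow> real mat" where
  "frame_mat k n A = mat (k * n) (k * n) (\<lambda>(p, q). (A ! (q div n)) $$ (p, q mod n))"

text \<open>Jets of fanning frames; intended for \<open>r \<ge> k - 1\<close>.\<close>

definition fanning_frame_jets :: "nat \<Rightarrow> nat \<Rightarrow> nat \<Rightarrow> real mat list set" where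
  "fanning_frame_jets r k n =
     {A. length A = Suc r \<and> set A \<subseteq> carrier_mat (k * n) n \<and> invertible_mat (frame_mat k n A)}"

definition GL_jets :: "nat \<Rightarrow> nat \<Rightarrow> real mat list set" where
  "GL_jets r n = {X. length X = Suc r \<and> set X \<subseteq> carrier_mat n n \<and> invertible_mat (X ! 0)}"

definition jet_act :: "nat \<Rightarrow> nat \<Rightarrow> nat \<Rightarrow> real mat list \<Rightarrow> real mat list \<Rightarrow> real mat list" where
  "jet_act r k n A X =
     map (\<lambda>m. mat_sum (k * n) n (\<lambda>i. real (m choose i) \<cdot>\<^sub>m (A ! (m - i) * X ! i)) {0..m}) [0..<Suc r]"

definition jet_rel :: "nat \<Rightarrow> nat \<Rightarrow> nat \<Rightarrow> (real mat list \<times> real mat list) set" where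
  "jet_rel r k n = {(A, jet_act r k n A X) | A X. A \<in> fanning_frame_jets r k n \<and> X \<in> GL_jets r n}"

definition fanning_curve_jets :: "nat \<Rightarrow> nat \<Rightarrow> nat \<Rightarrow> real mat list set set" where
  "fanning_curve_jets r k n = fanning_frame_jets r k n // jet_rel r k n"

definition jet_class :: "nat \<Rightarrow> nat \<Rightarrow> nat \<Rightarrow> real mat list \<Rightarrow> real mat list set" where
  "jet_class r k n A = jet_rel r k n `` {A}"

definition GL_act_frame :: "real mat \<Rightarrow> real mat list \<Rightarrow> real mat list" where
  "GL_act_frame T A = map (\<lambda>B. T * B) A"

text \<open>The action of \<open>T\<close> on frames commutes with \<^const>\<open>jet_act\<close>, so the induced action on the
  quotient sends a class to its image.\<close>

definition GL_act_curve :: "real mat \<Rightarrow> real mat list set \<Rightarrow> real mat list set" where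
  "GL_act_curve T c = GL_act_frame T ` c"

definition GL_equivariant :: "nat \<Rightarrow> nat \<Rightarrow> nat \<Rightarrow> (real mat list set \<Rightarrow> real mat) \<Rightarrow> bool" where
  "GL_equivariant r k n f \<longleftrightarrow>
     (\<forall>T \<in> GL (k * n). \<forall>c \<in> fanning_curve_jets r k n. f (GL_act_curve T c) = T * f c * minv T)"

text \<open>With blocks numbered from 0, block \<open>(b, b + 1)\<close> is \<open>(b + 1) I\<close> and all other blocks vanish.\<close>

definition nilp_mat :: "nat \<Rightarrow> nat \<Rightarrow> real mat" where
  "nilp_mat k n = mat (k * n) (k * n)
     (\<lambda>(p, q). if q div n = Suc (p div n) \<and> q mod n = p mod n then real (q div n) else 0)"

definition fund_endo :: "nat \<Rightarrow> nat \<Rightarrow> real mat list \<Rightarrow> real mat" where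
  "fund_endo k n A = frame_mat k n A * nilp_mat k n * minv (frame_mat k n A)"

definition fund_poly :: "nat \<Rightarrow> nat \<Rightarrow> (nat \<Rightarrow> real) \<Rightarrow> real mat list \<Rightarrow> real mat" where
  "fund_poly k n a A =
     mat_sum (k * n) (k * n) (\<lambda>i. (a i / fact i) \<cdot>\<^sub>m (fund_endo k n A ^\<^sub>m i)) {0..k - 1}"

end

theory Submission
  imports Defs "Jordan_Normal_Form.Determinant"
begin

text \<open>Write \<open>N\<close> for the matrix \<^const>\<open>nilp_mat\<close>. A jet of fanning frames is the same as an invertible matrix
  \<open>\<^bold>A\<close>, on which \<open>GL(kn)\<close> acts by left multiplication. The Leibniz rule makes a jet of invertible
  matrices act by right multiplication with a block upper triangular matrix \<open>U(X)\<close>, whose block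
  \<open>(a, b)\<close> is \<open>(b choose a) X\<^bsub>b-a\<^esub>\<close> (\<open>jet_mat\<close>). So the space of fanning curve jets is \<open>GL(kn) / G\<close>
  for the group \<open>G\<close> of the \<open>U(X)\<close>, and an equivariant map on it is the same as a matrix \<open>M\<close>, its value
  at the class of the frame \<open>\<^bold>A\<close> = identity, that is fixed under conjugation by \<open>G\<close>.

  The point that makes everything fit is that \<open>G\<close> is exactly the centralizer of \<open>N\<close> in \<open>GL(kn)\<close>
  (\<open>jet_mat_commutes_nilp\<close>, \<open>commutes_nilp_imp_jet_mat\<close>, \<open>jet_mat_GL_iff\<close>). Two frames therefore
  represent the same curve jet if and only if they have the same fundamental endomorphism
  \<open>F = \<^bold>A N \<^bold>A\<inverse>\<close> (\<open>jet_class_eq_fibre\<close>), so that everything computed from \<open>F\<close> descends to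
  the quotient, and equivariance of polynomials in \<open>F\<close> is clear.

  Conversely \<open>M\<close> has to commute with the centralizer of \<open>N\<close> (\<open>commutes_centralizer_imp_scalar_blocks\<close>). It
  commutes with the unipotent \<open>1 + N\<close>, hence with \<open>N\<close>, hence is itself some \<open>U(X)\<close>; it also commutes
  with all block diagonal matrices \<open>diag(Z, \<dots>, Z)\<close>, which forces every \<open>X\<^bsub>i\<^esub>\<close> to be a scalar \<open>a\<^bsub>i\<^esub>\<close>. Since
  \<open>U(X)\<close> for the jet with the identity at position \<open>i\<close> and zeros elsewhere is \<open>N\<^bsup>i\<^esup> / i!\<close>, this says
  \<open>M = \<Sum>\<^bsub>i\<^esub> a\<^bsub>i\<^esub> N\<^bsup>i\<^esup> / i!\<close> (\<open>mat_sum_nilp_pow\<close>).\<close>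

section \<open>Block indices\<close>

lemma mult_mat_entry:
  assumes "A \<in> carrier_mat m l" "B \<in> carrier_mat l r" "i < m" "j < r"
  shows "(A * B) $$ (i, j) = (\<Sum>t<l. A $$ (i, t) * B $$ (t, j))"
  using assms by (auto simp: scalar_prod_def atLeast0LessThan intro!: sum.cong)

lemma block_index_less:
  assumes "c < k" "s < n"
  shows "c * n + s < k * (n::nat)"
proof -
  have "c * n + s < Suc c * n" using assms(2) by simp
  also have "\<dots> \<le> k * n" using assms(1) by (intro mult_le_mono1) simp
  finally show ?thesis .
qed

lemma block_index_div_mod:
  assumes "p < k * (n::nat)"
  shows "p div n < k" "p mod n < n" "n > 0"
proof -
  show n: "n > 0" using assms by (cases n) auto
  show "p div n < k" using assms by (simp add: less_mult_imp_div_less)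
  show "p mod n < n" using n by simp
qed

lemma sum_blocks:
  fixes f :: "nat \<Rightarrow> real"
  shows "(\<Sum>t<k * n. f t) = (\<Sum>c<k. \<Sum>s<n. f (c * n + s))"
proof -
  have "(\<Sum>t<k * n. f t) = (\<Sum>c<k. sum f {c * n..<c * n + n})"
    by (rule sum.nat_group[symmetric])
  moreover have "sum f {c * n..<c * n + n} = (\<Sum>s<n. f (c * n + s))" for c
    using sum.shift_bounds_nat_ivl[of f 0 "c * n" n] by (simp add: atLeast0LessThan add.commute)
  ultimately show ?thesis by simp
qed

lemma eq_matI_blocks:
  assumes "A \<in> carrier_mat (k * n) (k * n)" "B \<in> carrier_mat (k * n) (k * n)"
    and "\<And>a b p q. a < k \<Longrightarrow> b < k \<Longrightarrow> p < n \<Longrightarrow> q < n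
           \<Longrightarrow> A $$ (a * n + p, b * n + q) = B $$ (a * n + p, b * n + q)"
  shows "A = B"
proof (rule eq_matI)
  fix i j assume "i < dim_row B" "j < dim_col B"
  then have i: "i < k * n" and j: "j < k * n" using assms(2) by auto
  show "A $$ (i, j) = B $$ (i, j)"
    using assms(3)[of "i div n" "j div n" "i mod n" "j mod n"]
      block_index_div_mod[OF i] block_index_div_mod[OF j] by simp
qed (use assms in auto)

section \<open>The matrices of the jet action\<close>

text \<open>The \<open>m\<close>-th entry of the product of two jets. The left factor may be rectangular, so that this
  covers both the action on frames (\<open>r = kn\<close>) and the group law of jets (\<open>r = n\<close>).\<close>

definition leibniz :: "nat \<Rightarrow> nat \<Rightarrow> (nat \<Rightarrow> real mat) \<Rightarrow> (nat \<Rightarrow> real mat) \<Rightarrow> nat \<Rightarrow> real mat" where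
  "leibniz r n A X m = mat_sum r n (\<lambda>i. real (m choose i) \<cdot>\<^sub>m (A (m - i) * X i)) {0..m}"

text \<open>The matrix by which the jet \<open>X\<close> acts on frame matrices from the right. The binomial coefficient
  vanishes below the block diagonal, where the truncated difference would be meaningless.\<close>

definition jet_mat :: "nat \<Rightarrow> nat \<Rightarrow> (nat \<Rightarrow> real mat) \<Rightarrow> real mat" where
  "jet_mat k n X = mat (k * n) (k * n)
     (\<lambda>(p, q). real (q div n choose p div n) * X (q div n - p div n) $$ (p mod n, q mod n))"

definition jet_monom :: "nat \<Rightarrow> nat \<Rightarrow> real mat \<Rightarrow> nat \<Rightarrow> real mat" where
  "jet_monom n j Z i = (if i = j then Z else 0\<^sub>m n n)"

lemma jet_mat_carrier [simp]: "jet_mat k n X \<in> carrier_mat (k * n) (k * n)"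
  by (simp add: jet_mat_def)

lemma jet_mat_block:
  assumes "a < k" "b < k" "p < n" "q < n"
  shows "jet_mat k n X $$ (a * n + p, b * n + q) = real (b choose a) * X (b - a) $$ (p, q)"
  using assms block_index_less[of a k p n] block_index_less[of b k q n] by (simp add: jet_mat_def)

lemma jet_mat_cong:
  assumes "\<And>i. i < k \<Longrightarrow> X i = Y i"
  shows "jet_mat k n X = jet_mat k n Y"
proof (rule eq_matI_blocks)
  fix a b p q :: nat
  assume "a < k" "b < k" "p < n" "q < n"
  then show "jet_mat k n X $$ (a * n + p, b * n + q) = jet_mat k n Y $$ (a * n + p, b * n + q)"
    using assms[of "b - a"] by (simp add: jet_mat_block)
qed auto

text \<open>The columns of the left factor are combined by the Leibniz rule. Both the action on frames and
  the multiplicativity of \<open>jet_mat\<close> are instances, since \<open>C\<close> is arbitrary.\<close>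

lemma mult_jet_mat_block:
  assumes C: "C \<in> carrier_mat (k * n) (k * n)" and "i < k * n" "b < k" "q < n"
  shows "(C * jet_mat k n X) $$ (i, b * n + q) =
           (\<Sum>j\<le>b. real (b choose j) * (\<Sum>s<n. C $$ (i, (b - j) * n + s) * X j $$ (s, q)))"
proof -
  let ?g = "\<lambda>c. real (b choose c) * (\<Sum>s<n. C $$ (i, c * n + s) * X (b - c) $$ (s, q))"
  have "(C * jet_mat k n X) $$ (i, b * n + q) =
          (\<Sum>c<k. \<Sum>s<n. C $$ (i, c * n + s) * jet_mat k n X $$ (c * n + s, b * n + q))"
    using assms by (subst mult_mat_entry[OF C jet_mat_carrier]) (auto simp: sum_blocks block_index_less)
  also have "\<dots> = (\<Sum>c<k. ?g c)"
    using assms by (intro sum.cong) (auto simp: jet_mat_block sum_distrib_left mult_ac)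
  also have "\<dots> = (\<Sum>c\<le>b. ?g c)"
    using assms by (intro sum.mono_neutral_right) auto
  also have "\<dots> = (\<Sum>j\<le>b. ?g (b - j))"
    by (rule sum.reindex_bij_witness[of _ "\<lambda>j. b - j" "\<lambda>j. b - j"]) auto
  also have "\<dots> = (\<Sum>j\<le>b. real (b choose j) * (\<Sum>s<n. C $$ (i, (b - j) * n + s) * X j $$ (s, q)))"
    by (intro sum.cong) (auto simp: binomial_symmetric[symmetric])
  finally show ?thesis .
qed

lemma leibniz_carrier [simp]: "leibniz r n A X m \<in> carrier_mat r n"
  by (simp add: leibniz_def mat_sum_def)

lemma leibniz_entry:
  assumes "\<And>i. i \<le> m \<Longrightarrow> A i \<in> carrier_mat r n" "\<And>i. i \<le> m \<Longrightarrow> X i \<in> carrier_mat n n" "p < r" "q < n"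
  shows "leibniz r n A X m $$ (p, q) =
           (\<Sum>j\<le>m. real (m choose j) * (\<Sum>s<n. A (m - j) $$ (p, s) * X j $$ (s, q)))"
proof -
  have "(real (m choose j) \<cdot>\<^sub>m (A (m - j) * X j)) $$ (p, q) =
          real (m choose j) * (\<Sum>s<n. A (m - j) $$ (p, s) * X j $$ (s, q))" if "j \<le> m" for j
    using assms(1)[of "m - j"] assms(2)[OF that] assms(3,4)
    by (subst index_smult_mat) (auto simp: mult_mat_entry simp del: index_mult_mat(1))
  then show ?thesis using assms(3,4)
    by (auto simp: leibniz_def mat_sum_def atLeast0AtMost intro!: sum.cong)
qed

text \<open>Composition of jets becomes multiplication of matrices because
  \<open>(b choose j) (b - j choose a) = (b choose a) (b - a choose j)\<close>.\<close>

lemma jet_mat_mult: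
  assumes X: "\<And>i. i < k \<Longrightarrow> X i \<in> carrier_mat n n" and Y: "\<And>i. i < k \<Longrightarrow> Y i \<in> carrier_mat n n"
  shows "jet_mat k n X * jet_mat k n Y = jet_mat k n (leibniz n n X Y)"
proof (rule eq_matI_blocks)
  fix a b p q :: nat
  assume ab: "a < k" "b < k" and pq: "p < n" "q < n"
  let ?h = "\<lambda>j. \<Sum>s<n. X (b - j - a) $$ (p, s) * Y j $$ (s, q)"
  have "(jet_mat k n X * jet_mat k n Y) $$ (a * n + p, b * n + q) =
          (\<Sum>j\<le>b. real (b choose j) * (\<Sum>s<n. jet_mat k n X $$ (a * n + p, (b - j) * n + s) * Y j $$ (s, q)))"
    using ab pq by (intro mult_jet_mat_block) (auto simp: block_index_less)
  also have "\<dots> = (\<Sum>j\<le>b. real (b choose j) * (real (b - j choose a) * ?h j))"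
  proof (intro sum.cong refl)
    fix j
    have "(\<Sum>s<n. jet_mat k n X $$ (a * n + p, (b - j) * n + s) * Y j $$ (s, q)) =
            (\<Sum>s<n. real (b - j choose a) * X (b - j - a) $$ (p, s) * Y j $$ (s, q))"
      using ab pq by (intro sum.cong refl, subst jet_mat_block) auto
    then show "real (b choose j) * (\<Sum>s<n. jet_mat k n X $$ (a * n + p, (b - j) * n + s) * Y j $$ (s, q)) =
        real (b choose j) * (real (b - j choose a) * ?h j)"
      by (simp add: sum_distrib_left mult.assoc)
  qed
  also have "\<dots> = real (b choose a) * (\<Sum>j\<le>b - a. real (b - a choose j) * ?h j)"
  proof (cases "a \<le> b")
    case True
    have "real (b choose j) * real (b - j choose a) = real (b choose a) * real (b - a choose j)"
      if "j \<le> b - a" for j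
    proof -
      have le: "a \<le> b - j" "j \<le> b" using that True by auto
      have "(b choose (b - j)) * (b - j choose a) = (b choose a) * (b - a choose (b - j - a))"
        using le by (intro choose_mult) auto
      moreover have "b choose (b - j) = b choose j" using le by (simp add: binomial_symmetric[symmetric])
      moreover have "b - a choose (b - j - a) = b - a choose j"
        using binomial_symmetric[OF that] by (simp add: add.commute)
      ultimately show ?thesis by (metis of_nat_mult)
    qed
    then have "(\<Sum>j\<le>b - a. real (b choose j) * (real (b - j choose a) * ?h j)) =
                 real (b choose a) * (\<Sum>j\<le>b - a. real (b - a choose j) * ?h j)"
      by (simp add: sum_distrib_left mult.assoc[symmetric])
    moreover have "(\<Sum>j\<le>b. real (b choose j) * (real (b - j choose a) * ?h j)) =
                     (\<Sum>j\<le>b - a. real (b choose j) * (real (b - j choose a) * ?h j))"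
      by (intro sum.mono_neutral_right) (auto simp: not_le intro!: binomial_eq_0)
    ultimately show ?thesis by simp
  next
    case False
    then show ?thesis by (simp add: binomial_eq_0)
  qed
  also have "\<dots> = real (b choose a) * leibniz n n X Y (b - a) $$ (p, q)"
    using ab pq X Y by (subst leibniz_entry) (auto simp: diff_diff_left add.commute)
  also have "\<dots> = jet_mat k n (leibniz n n X Y) $$ (a * n + p, b * n + q)"
    using ab pq by (simp add: jet_mat_block)
  finally show "(jet_mat k n X * jet_mat k n Y) $$ (a * n + p, b * n + q) =
      jet_mat k n (leibniz n n X Y) $$ (a * n + p, b * n + q)" .
qed (auto intro: mult_carrier_mat[OF jet_mat_carrier jet_mat_carrier])

lemma leibniz_monom_right:
  assumes X: "\<And>i. i \<le> m \<Longrightarrow> X i \<in> carrier_mat n n" and Z: "Z \<in> carrier_mat n n"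
  shows "leibniz n n X (jet_monom n j Z) m =
           (if j \<le> m then real (m choose j) \<cdot>\<^sub>m (X (m - j) * Z) else 0\<^sub>m n n)"
proof (rule eq_matI)
  fix p q assume "p < dim_row (if j \<le> m then real (m choose j) \<cdot>\<^sub>m (X (m - j) * Z) else 0\<^sub>m n n)"
    "q < dim_col (if j \<le> m then real (m choose j) \<cdot>\<^sub>m (X (m - j) * Z) else 0\<^sub>m n n)"
  then have pq: "p < n" "q < n" using X[of "m - j"] Z by (auto split: if_splits)
  have Zj: "jet_monom n j Z i \<in> carrier_mat n n" for i using Z by (simp add: jet_monom_def)
  have "leibniz n n X (jet_monom n j Z) m $$ (p, q) =
      (\<Sum>i\<le>m. real (m choose i) * (\<Sum>s<n. X (m - i) $$ (p, s) * jet_monom n j Z i $$ (s, q)))"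
    using X Zj pq by (rule leibniz_entry)
  also have "\<dots> =
      (\<Sum>i\<le>m. if i = j then real (m choose j) * (\<Sum>s<n. X (m - j) $$ (p, s) * Z $$ (s, q)) else 0)"
    using pq by (intro sum.cong) (auto simp: jet_monom_def)
  also have "\<dots> = (if j \<le> m then real (m choose j) \<cdot>\<^sub>m (X (m - j) * Z) else 0\<^sub>m n n) $$ (p, q)"
    using pq X[of "m - j"] Z mult_mat_entry[of "X (m - j)" n n Z n p q] by auto
  finally show "leibniz n n X (jet_monom n j Z) m $$ (p, q) =
    (if j \<le> m then real (m choose j) \<cdot>\<^sub>m (X (m - j) * Z) else 0\<^sub>m n n) $$ (p, q)" .
qed (use X[of "m - j"] Z in \<open>auto simp: leibniz_def mat_sum_def\<close>)

lemma leibniz_monom_left: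
  assumes Y: "\<And>i. i \<le> m \<Longrightarrow> Y i \<in> carrier_mat n n" and Z: "Z \<in> carrier_mat n n"
  shows "leibniz n n (jet_monom n j Z) Y m =
           (if j \<le> m then real (m choose j) \<cdot>\<^sub>m (Z * Y (m - j)) else 0\<^sub>m n n)"
proof (rule eq_matI)
  fix p q assume "p < dim_row (if j \<le> m then real (m choose j) \<cdot>\<^sub>m (Z * Y (m - j)) else 0\<^sub>m n n)"
    "q < dim_col (if j \<le> m then real (m choose j) \<cdot>\<^sub>m (Z * Y (m - j)) else 0\<^sub>m n n)"
  then have pq: "p < n" "q < n" using Y[of "m - j"] Z by (auto split: if_splits)
  have Zj: "jet_monom n j Z i \<in> carrier_mat n n" for i using Z by (simp add: jet_monom_def)
  have "leibniz n n (jet_monom n j Z) Y m $$ (p, q) =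
      (\<Sum>i\<le>m. real (m choose i) * (\<Sum>s<n. jet_monom n j Z (m - i) $$ (p, s) * Y i $$ (s, q)))"
    using Zj Y pq by (rule leibniz_entry)
  also have "\<dots> = (\<Sum>i\<le>m. if i = m - j \<and> j \<le> m then real (m choose j) * (\<Sum>s<n. Z $$ (p, s) * Y (m - j) $$ (s, q)) else 0)"
    using pq by (intro sum.cong) (auto simp: jet_monom_def binomial_symmetric[symmetric])
  also have "\<dots> = (if j \<le> m then real (m choose j) \<cdot>\<^sub>m (Z * Y (m - j)) else 0\<^sub>m n n) $$ (p, q)"
    using pq Y[of "m - j"] Z mult_mat_entry[of Z n n "Y (m - j)" n p q] by auto
  finally show "leibniz n n (jet_monom n j Z) Y m $$ (p, q) =
    (if j \<le> m then real (m choose j) \<cdot>\<^sub>m (Z * Y (m - j)) else 0\<^sub>m n n) $$ (p, q)" .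
qed (use Y[of "m - j"] Z in \<open>auto simp: leibniz_def mat_sum_def\<close>)

lemma one_eq_jet_mat: "1\<^sub>m (k * n) = jet_mat k n (jet_monom n 0 (1\<^sub>m n))"
proof (rule eq_matI_blocks)
  fix a b p q :: nat
  assume *: "a < k" "b < k" "p < n" "q < n"
  have "a * n + p = b * n + q \<longleftrightarrow> a = b \<and> p = q"
    using * by (metis div_mult_self3 div_less mod_less mod_mult_self3 add_0_right gr_implies_not0)
  then show "1\<^sub>m (k * n) $$ (a * n + p, b * n + q) = jet_mat k n (jet_monom n 0 (1\<^sub>m n)) $$ (a * n + p, b * n + q)"
    using * by (auto simp: jet_mat_block jet_monom_def block_index_less)
qed auto

lemma nilp_mat_eq_jet_mat: "nilp_mat k n = jet_mat k n (jet_monom n 1 (1\<^sub>m n))"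
proof (rule eq_matI_blocks)
  fix a b p q :: nat
  assume *: "a < k" "b < k" "p < n" "q < n"
  have div_mod: "(a * n + p) div n = a" "(a * n + p) mod n = p" "(b * n + q) div n = b" "(b * n + q) mod n = q"
    using * by auto
  note less = block_index_less[OF *(1,3)] block_index_less[OF *(2,4)]
  have "nilp_mat k n $$ (a * n + p, b * n + q) = (if b = Suc a \<and> q = p then real b else 0)"
    unfolding nilp_mat_def using less by (simp only: index_mat prod.case div_mod)
  also have "\<dots> = jet_mat k n (jet_monom n 1 (1\<^sub>m n)) $$ (a * n + p, b * n + q)"
    unfolding jet_mat_block[OF *] using *
    by (cases "b - a = 1"; cases "b = Suc a") (auto simp: jet_monom_def)
  finally show "nilp_mat k n $$ (a * n + p, b * n + q) = jet_mat k n (jet_monom n 1 (1\<^sub>m n)) $$ (a * n + p, b * n + q)" .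
qed (auto simp: nilp_mat_def)

text \<open>Multiplying a jet from either side by the jet \<open>(0, 1, 0, \<dots>)\<close> gives the entries \<open>m X\<^bsub>m-1\<^esub>\<close>, so
  commutation with \<open>N\<close> is commutation of jets.\<close>

lemma jet_mat_commutes_nilp:
  assumes X: "\<And>i. i < k \<Longrightarrow> X i \<in> carrier_mat n n"
  shows "jet_mat k n X * nilp_mat k n = nilp_mat k n * jet_mat k n X"
proof -
  have J: "jet_monom n 1 (1\<^sub>m n) i \<in> carrier_mat n n" for i by (simp add: jet_monom_def)
  have "leibniz n n X (jet_monom n 1 (1\<^sub>m n)) i = leibniz n n (jet_monom n 1 (1\<^sub>m n)) X i" if "i < k" for i
  proof -
    have Xj: "X j \<in> carrier_mat n n" if "j \<le> i" for j using X that \<open>i < k\<close> by simp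
    have "X (i - 1) * 1\<^sub>m n = 1\<^sub>m n * X (i - 1)" using Xj[of "i - 1"] by simp
    then show ?thesis
      by (simp only: leibniz_monom_right[OF Xj one_carrier_mat] leibniz_monom_left[OF Xj one_carrier_mat])
  qed
  then show ?thesis
    unfolding nilp_mat_eq_jet_mat using X J by (subst (1 2) jet_mat_mult) (auto intro: jet_mat_cong)
qed

text \<open>\<open>N\<close> is the matrix of the jet \<open>(0, 1, 0, \<dots>)\<close> of the curve \<open>t \<mapsto> t I\<close>, so \<open>N\<^bsup>i\<^esup>\<close> is that of \<open>t \<mapsto> t\<^bsup>i\<^esup> I\<close>,
  whose only nonzero derivative at \<open>0\<close> is the \<open>i\<close>-th, equal to \<open>i! I\<close>.\<close>

lemma nilp_mat_pow: "nilp_mat k n ^\<^sub>m i = jet_mat k n (jet_monom n i (fact i \<cdot>\<^sub>m 1\<^sub>m n))"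
proof (induction i)
  case 0
  have "1 \<cdot>\<^sub>m 1\<^sub>m n = (1\<^sub>m n :: real mat)" by (rule eq_matI) auto
  then show ?case by (simp add: nilp_mat_def one_eq_jet_mat)
next
  case (Suc i)
  let ?Z = "\<lambda>i. fact i \<cdot>\<^sub>m (1\<^sub>m n :: real mat)"
  have J: "jet_monom n j (?Z i) l \<in> carrier_mat n n" "jet_monom n j (1\<^sub>m n) l \<in> carrier_mat n n" for j i l
    by (simp_all add: jet_monom_def)
  have "leibniz n n (jet_monom n i (?Z i)) (jet_monom n 1 (1\<^sub>m n)) m = jet_monom n (Suc i) (?Z (Suc i)) m" for m
    by (subst leibniz_monom_right[OF J(1)]) (auto intro!: eq_matI simp: jet_monom_def)
  then show ?case
    using J unfolding pow_mat.simps Suc.IH unfolding nilp_mat_eq_jet_mat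
    by (subst jet_mat_mult) (auto intro: jet_mat_cong)
qed

section \<open>Inverses and conjugation\<close>

lemma invertible_mat_iff_det:
  fixes A :: "real mat"
  assumes A: "A \<in> carrier_mat d d"
  shows "invertible_mat A \<longleftrightarrow> det A \<noteq> 0"
proof
  assume "invertible_mat A"
  then obtain B where B: "A * B = 1\<^sub>m d" "B * A = 1\<^sub>m (dim_row B)"
    using A by (auto simp: invertible_mat_def inverts_mat_def)
  have "B \<in> carrier_mat d d"
    using arg_cong[OF B(1), of dim_col] arg_cong[OF B(2), of dim_col] A by auto
  then have "det A * det B = 1" using det_mult[OF A, of B] B(1) by simp
  then show "det A \<noteq> 0" by auto
next
  assume "det A \<noteq> 0"
  then have "A \<in> Units (ring_mat TYPE(real) d ())" by (rule det_non_zero_imp_unit[OF A])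
  then show "invertible_mat A"
    using A by (auto simp: Units_def ring_mat_def invertible_mat_def inverts_mat_def)
qed

lemma minv:
  assumes "A \<in> GL d"
  shows minv_carrier: "minv A \<in> carrier_mat d d" and mult_minv: "A * minv A = 1\<^sub>m d" and minv_mult: "minv A * A = 1\<^sub>m d"
proof -
  have A: "A \<in> carrier_mat d d" and "det A \<noteq> 0"
    using assms invertible_mat_iff_det by (auto simp: GL_def)
  then have "A \<in> Units (ring_mat TYPE(real) d ())" by (metis det_non_zero_imp_unit)
  then obtain B where "mat_inverse A = Some B" using mat_inverse(1)[OF A, of "()"] by blast
  then show "minv A \<in> carrier_mat d d" "A * minv A = 1\<^sub>m d" "minv A * A = 1\<^sub>m d"
    using mat_inverse(2)[OF A] by (auto simp: minv_def)
qed

lemma GL_carrier: "A \<in> GL d \<Longrightarrow> A \<in> carrier_mat d d"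
  by (simp add: GL_def)

lemma right_inverse_unique:
  assumes A: "A \<in> carrier_mat d d" and B: "B \<in> carrier_mat d d" and AB: "A * B = 1\<^sub>m d"
  shows right_inverse_GL: "A \<in> GL d" and right_inverse_minv: "minv A = B"
proof -
  have "det A * det B = 1" using det_mult[OF A B] AB by simp
  then show GL: "A \<in> GL d" using A by (auto simp: GL_def invertible_mat_iff_det[OF A])
  have "minv A * (A * B) = minv A * A * B"
    using minv_carrier[OF GL] A B by (intro assoc_mult_mat[symmetric])
  then show "minv A = B"
    using AB minv_carrier[OF GL] minv_mult[OF GL] B by simp
qed

lemma one_GL: "1\<^sub>m d \<in> GL d" and minv_one: "minv (1\<^sub>m d) = 1\<^sub>m d"
  by (rule right_inverse_unique[of _ _ "1\<^sub>m d"]; simp)+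

lemma minv_GL: "A \<in> GL d \<Longrightarrow> minv A \<in> GL d" and minv_minv: "A \<in> GL d \<Longrightarrow> minv (minv A) = A"
  by (rule right_inverse_unique[of _ _ A]; simp add: minv GL_carrier)+

lemma GL_mult:
  assumes A: "A \<in> GL d" and B: "B \<in> GL d"
  shows mult_GL: "A * B \<in> GL d" and minv_of_mult: "minv (A * B) = minv B * minv A"
proof -
  note [simp] = GL_carrier[OF A] GL_carrier[OF B] minv_carrier[OF A] minv_carrier[OF B]
  have "A * B * (minv B * minv A) = A * (B * minv B) * minv A"
    by (simp add: assoc_mult_mat[of _ d d _ d _ d] mult_carrier_mat[of _ d d _ d])
  also have "\<dots> = 1\<^sub>m d" by (simp add: mult_minv[OF A] mult_minv[OF B] right_mult_one_mat[of _ d d])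
  finally have "A * B * (minv B * minv A) = 1\<^sub>m d" .
  from right_inverse_unique[OF _ _ this] show "A * B \<in> GL d" "minv (A * B) = minv B * minv A"
    by (auto simp: mult_carrier_mat[of _ d d _ d])
qed

lemma conj_mult:
  assumes A: "A \<in> GL d" and B: "B \<in> GL d" and M: "M \<in> carrier_mat d d"
  shows "(A * B) * M * minv (A * B) = A * (B * M * minv B) * minv A"
  using GL_carrier[OF A] GL_carrier[OF B] minv_carrier[OF A] minv_carrier[OF B] M
  by (simp add: minv_of_mult[OF A B] assoc_mult_mat[of _ d d _ d _ d] mult_carrier_mat[of _ d d _ d])

lemma conj_eq_iff_commute:
  assumes U: "U \<in> GL d" and M: "M \<in> carrier_mat d d"
  shows "U * M * minv U = M \<longleftrightarrow> U * M = M * U"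
proof
  note [simp] = GL_carrier[OF U] minv_carrier[OF U] M
  assume "U * M * minv U = M"
  then have "M * U = U * M * minv U * U" by simp
  also have "\<dots> = U * M * (minv U * U)" by (intro assoc_mult_mat[of _ d d _ d _ d] mult_carrier_mat[of _ d d _ d]) auto
  finally show "U * M = M * U" by (simp add: minv_mult[OF U] right_mult_one_mat[of _ d d] mult_carrier_mat[of _ d d _ d])
next
  note [simp] = GL_carrier[OF U] minv_carrier[OF U] M
  assume "U * M = M * U"
  then show "U * M * minv U = M"
    by (simp add: assoc_mult_mat[of _ d d _ d _ d] mult_minv[OF U] right_mult_one_mat[of _ d d])
qed

lemma conj_minv:
  assumes U: "U \<in> GL d" and M: "M \<in> carrier_mat d d"
  shows "minv U * (U * M * minv U) * U = M"
proof -
  note [simp] = GL_carrier[OF U] minv_carrier[OF U] M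
  have "minv U * (U * M * minv U) * U = (minv U * U) * M * (minv U * U)"
    by (simp add: assoc_mult_mat[of _ d d _ d _ d] mult_carrier_mat[of _ d d _ d])
  then show ?thesis by (simp add: minv_mult[OF U] left_mult_one_mat[of _ d d] right_mult_one_mat[of _ d d])
qed

lemma minv_commute:
  assumes U: "U \<in> GL d" and M: "M \<in> carrier_mat d d" and c: "U * M = M * U"
  shows "minv U * M = M * minv U"
proof -
  have "U * M * minv U = M" using c conj_eq_iff_commute[OF U M] by simp
  then have "minv U * M * U = M" using conj_minv[OF U M] by simp
  then show ?thesis using conj_eq_iff_commute[OF minv_GL[OF U] M] minv_minv[OF U] by simp
qed

section \<open>The centralizer of the nilpotent matrix\<close>

text \<open>Comparing the blocks \<open>(a, b)\<close> of \<open>UN = NU\<close> gives \<open>(a + 1) U\<^bsub>a+1,b\<^esub> = b U\<^bsub>a,b-1\<^esub>\<close>. Hence the first block row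
  determines \<open>U\<close>, and this recursion is the one satisfied by the binomial coefficients:
  \<open>U\<^bsub>a,b\<^esub> = (b choose a) U\<^bsub>0,b-a\<^esub>\<close>.\<close>

lemma commutes_nilp_imp_jet_mat:
  assumes U: "U \<in> carrier_mat (k * n) (k * n)" and comm: "U * nilp_mat k n = nilp_mat k n * U"
  obtains X where "\<And>i. X i \<in> carrier_mat n n" "U = jet_mat k n X"
proof -
  let ?u = "\<lambda>a p b q. U $$ (a * n + p, b * n + q)"
  have N: "nilp_mat k n \<in> carrier_mat (k * n) (k * n)" by (simp add: nilp_mat_def)
  have UN: "(U * nilp_mat k n) $$ (i, b * n + q) = real b * U $$ (i, (b - 1) * n + q)"
    if "i < k * n" "b < k" "q < n" for i b q
  proof -
    have "(U * nilp_mat k n) $$ (i, b * n + q) = (\<Sum>j\<le>b. real (b choose j) *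
            (\<Sum>s<n. U $$ (i, (b - j) * n + s) * jet_monom n 1 (1\<^sub>m n) j $$ (s, q)))"
      unfolding nilp_mat_eq_jet_mat using U that by (rule mult_jet_mat_block)
    also have "\<dots> = (\<Sum>j\<le>b. if j = 1 then real b * U $$ (i, (b - 1) * n + q) else 0)"
    proof (intro sum.cong refl)
      fix j
      have "(\<Sum>s<n. U $$ (i, (b - 1) * n + s) * 1\<^sub>m n $$ (s, q)) =
              (\<Sum>s<n. if s = q then U $$ (i, (b - 1) * n + q) else 0)"
        using that by (intro sum.cong) auto
      then show "real (b choose j) * (\<Sum>s<n. U $$ (i, (b - j) * n + s) * jet_monom n 1 (1\<^sub>m n) j $$ (s, q)) =
          (if j = 1 then real b * U $$ (i, (b - 1) * n + q) else 0)"
        using that by (auto simp: jet_monom_def)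
    qed
    also have "\<dots> = real b * U $$ (i, (b - 1) * n + q)" by (cases b) auto
    finally show ?thesis .
  qed
  have NU: "(nilp_mat k n * U) $$ (a * n + p, j) = real (Suc a) * U $$ (Suc a * n + p, j)"
    if "j < k * n" "Suc a < k" "p < n" for a p j
  proof -
    have "(nilp_mat k n * U) $$ (a * n + p, j) =
            (\<Sum>c<k. \<Sum>s<n. nilp_mat k n $$ (a * n + p, c * n + s) * U $$ (c * n + s, j))"
      using that by (subst mult_mat_entry[OF N U]) (auto simp: sum_blocks block_index_less)
    also have "\<dots> = (\<Sum>c<k. if c = Suc a then real (Suc a) * U $$ (Suc a * n + p, j) else 0)"
    proof (intro sum.cong refl)
      fix c assume c: "c \<in> {..<k}"
      have "nilp_mat k n $$ (a * n + p, c * n + s) =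
              (if c = Suc a \<and> s = p then real (Suc a) else 0)" if "s < n" for s
      proof -
        have "nilp_mat k n $$ (a * n + p, c * n + s) =
                real (c choose a) * jet_monom n 1 (1\<^sub>m n) (c - a) $$ (p, s)"
          unfolding nilp_mat_eq_jet_mat using c that \<open>Suc a < k\<close> \<open>p < n\<close> by (intro jet_mat_block) auto
        then show ?thesis
          using that \<open>p < n\<close> by (cases "c = Suc a") (auto simp: jet_monom_def)
      qed
      then have "(\<Sum>s<n. nilp_mat k n $$ (a * n + p, c * n + s) * U $$ (c * n + s, j)) =
          (\<Sum>s<n. if s = p then (if c = Suc a then real (Suc a) * U $$ (Suc a * n + p, j) else 0) else 0)"
        by (intro sum.cong) auto
      then show "(\<Sum>s<n. nilp_mat k n $$ (a * n + p, c * n + s) * U $$ (c * n + s, j)) =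
          (if c = Suc a then real (Suc a) * U $$ (Suc a * n + p, j) else 0)"
        using \<open>p < n\<close> by simp
    qed
    also have "\<dots> = real (Suc a) * U $$ (Suc a * n + p, j)" using that by simp
    finally show ?thesis .
  qed
  \<comment> \<open>For \<open>b = 0\<close> the truncated index \<open>b - 1\<close> is harmless because of the factor \<open>b\<close>.\<close>
  have rec: "real (Suc a) * ?u (Suc a) p b q = real b * ?u a p (b - 1) q"
    if "Suc a < k" "b < k" "p < n" "q < n" for a p b q
    using comm that UN[of "a * n + p" b q] NU[of "b * n + q" a p] by (simp add: block_index_less)
  have blocks: "?u a p b q = real (b choose a) * U $$ (p, (b - a) * n + q)"
    if "a < k" "b < k" "p < n" "q < n" for a b p q
    using that
  proof (induction a arbitrary: b)
    case 0
    then show ?case by simp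
  next
    case (Suc a)
    note rec = rec[OF Suc.prems]
    show ?case
    proof (cases b)
      case 0
      then show ?thesis using rec by simp
    next
      case (Suc b')
      have "real (Suc a) * ?u (Suc a) p b q = real (Suc b') * (real (b' choose a) * U $$ (p, (b' - a) * n + q))"
        using rec Suc Suc.IH[of b'] Suc.prems by simp
      also have "\<dots> = real (Suc a) * (real (b choose Suc a) * U $$ (p, (b - Suc a) * n + q))"
        using arg_cong[OF Suc_times_binomial[of a b'], of real] unfolding Suc of_nat_mult
        by (simp only: mult.assoc[symmetric] diff_Suc_Suc)
      finally show ?thesis by (simp del: of_nat_Suc)
    qed
  qed
  show thesis
  proof (rule that)
    let ?X = "\<lambda>i. mat n n (\<lambda>(p, q). U $$ (p, i * n + q))"
    show "?X i \<in> carrier_mat n n" for i by simp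
    show "U = jet_mat k n ?X"
      using U by (intro eq_matI_blocks[of _ k n]) (auto simp: jet_mat_block blocks)
  qed
qed

text \<open>The inverse of a matrix in the centralizer of \<open>N\<close> is again of the form \<open>jet_mat\<close>, and the first
  diagonal block is multiplicative. In the other direction, normalizing \<open>X\<^bsub>0\<^esub>\<close> to the identity
  leaves a unipotent matrix.\<close>

lemma jet_mat_GL_iff:
  assumes X: "\<And>i. i < k \<Longrightarrow> X i \<in> carrier_mat n n" and k: "k > 0"
  shows "jet_mat k n X \<in> GL (k * n) \<longleftrightarrow> invertible_mat (X 0)"
proof
  let ?U = "jet_mat k n X"
  assume U: "?U \<in> GL (k * n)"
  have N: "nilp_mat k n \<in> carrier_mat (k * n) (k * n)" by (simp add: nilp_mat_def)
  have comm: "minv ?U * nilp_mat k n = nilp_mat k n * minv ?U"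
    using U N jet_mat_commutes_nilp[OF X] by (rule minv_commute)
  obtain Y where Y: "\<And>i. Y i \<in> carrier_mat n n" "minv ?U = jet_mat k n Y"
    using commutes_nilp_imp_jet_mat[OF minv_carrier[OF U] comm] by blast
  have prod: "jet_mat k n (leibniz n n X Y) = jet_mat k n (jet_monom n 0 (1\<^sub>m n))"
    using mult_minv[OF U] jet_mat_mult[OF X Y(1)] by (simp add: Y(2) one_eq_jet_mat)
  have "X 0 * Y 0 = 1\<^sub>m n"
  proof (rule eq_matI)
    fix p q assume "p < dim_row (1\<^sub>m n :: real mat)" "q < dim_col (1\<^sub>m n :: real mat)"
    then have pq: "p < n" "q < n" by auto
    have "(X 0 * Y 0) $$ (p, q) = leibniz n n X Y 0 $$ (p, q)"
      using X[OF k] Y(1)[of 0] pq by (simp add: leibniz_def mat_sum_def)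
    also have "\<dots> = 1\<^sub>m n $$ (p, q)"
      using jet_mat_block[of 0 k 0 p n q "leibniz n n X Y"]
        jet_mat_block[of 0 k 0 p n q "jet_monom n 0 (1\<^sub>m n)"] prod k pq
      by (simp add: jet_monom_def)
    finally show "(X 0 * Y 0) $$ (p, q) = 1\<^sub>m n $$ (p, q)" .
  qed (use X[OF k] Y(1)[of 0] in auto)
  then show "invertible_mat (X 0)" using right_inverse_GL[OF X[OF k] Y(1)] by (simp add: GL_def)
next
  let ?U = "jet_mat k n X"
  assume inv: "invertible_mat (X 0)"
  then have X0: "X 0 \<in> GL n" using X[OF k] by (simp add: GL_def)
  define Z where "Z = minv (X 0)"
  have Z: "Z \<in> carrier_mat n n" "X 0 * Z = 1\<^sub>m n" using minv[OF X0] by (auto simp: Z_def)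
  let ?D = "jet_mat k n (jet_monom n 0 Z)"
  have "?U * ?D = jet_mat k n (leibniz n n X (jet_monom n 0 Z))"
    using X Z by (intro jet_mat_mult) (auto simp: jet_monom_def)
  also have "\<dots> = jet_mat k n (\<lambda>i. X i * Z)"
  proof (rule jet_mat_cong)
    fix i assume "i < k"
    then have Xj: "X j \<in> carrier_mat n n" if "j \<le> i" for j using X that by simp
    show "leibniz n n X (jet_monom n 0 Z) i = X i * Z"
      by (subst leibniz_monom_right[OF Xj Z(1)]) (auto intro: eq_matI)
  qed
  finally have UD: "?U * ?D = jet_mat k n (\<lambda>i. X i * Z)" (is "_ = ?W") .
  have entry: "?W $$ (i, j) = (if i = j then 1 else 0)" if "j \<le> i" "i < k * n" for i j
  proof (cases "j div n < i div n")
    case True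
    then show ?thesis using that by (auto simp: jet_mat_def)
  next
    case False
    then have eq: "j div n = i div n" using that by (metis div_le_mono le_neq_implies_less)
    moreover have "i = j \<longleftrightarrow> i mod n = j mod n" using eq by (metis div_mult_mod_eq)
    moreover have "n > 0" using that by (cases n) auto
    ultimately show ?thesis using that Z by (auto simp: jet_mat_def)
  qed
  have "upper_triangular ?W" using entry by (intro upper_triangularI) (auto simp: jet_mat_def)
  then have "det ?W = prod_list (diag_mat ?W)" by (rule det_upper_triangular[OF _ jet_mat_carrier])
  also have "diag_mat ?W = map (\<lambda>i. 1) [0..<k * n]"
    by (auto simp: diag_mat_def carrier_matD(1)[OF jet_mat_carrier] entry)
  also have "prod_list \<dots> = 1" by (simp add: map_replicate_const)
  finally have "det ?U * det ?D = 1" using UD det_mult[of ?U "k * n" ?D] by simp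
  then have "det ?U \<noteq> 0" by auto
  then show "?U \<in> GL (k * n)" by (simp add: GL_def invertible_mat_iff_det[of _ "k * n"])
qed

text \<open>It is enough to test against the transvections \<open>1 + E\<^bsub>pq\<^esub>\<close> with \<open>p \<noteq> q\<close>, which are unipotent.\<close>

lemma commutes_GL_imp_scalar:
  assumes C: "C \<in> carrier_mat n n" and comm: "\<And>Z. Z \<in> GL n \<Longrightarrow> C * Z = Z * C"
  shows "\<exists>c. C = c \<cdot>\<^sub>m 1\<^sub>m n"
proof -
  have *: "C $$ (p, p) = C $$ (q, q) \<and> C $$ (q, p) = 0" if pq: "p < n" "q < n" "p \<noteq> q" for p q
  proof -
    let ?E = "mat n n (\<lambda>(i, j). if i = j then 1 else if i = p \<and> j = q then 1 else (0 :: real))"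
    have "?E = addrow_mat n 1 p q" using pq by (auto simp: addrow_mat_def)
    then have "det ?E = 1" using det_addrow_mat[OF pq(3), of n "1 :: real"] by simp
    then have "?E \<in> GL n" by (simp add: GL_def invertible_mat_iff_det[of _ n])
    then have CE: "C * ?E = ?E * C" by (rule comm)
    have right: "(C * ?E) $$ (i, q) = C $$ (i, q) + C $$ (i, p)" if "i < n" for i
    proof -
      have "(C * ?E) $$ (i, q) = (\<Sum>t<n. C $$ (i, t) * ?E $$ (t, q))"
        using C that pq by (intro mult_mat_entry) auto
      also have "\<dots> = (\<Sum>t<n. (if t = q then C $$ (i, q) else 0) + (if t = p then C $$ (i, p) else 0))"
        using pq by (intro sum.cong) auto
      finally show ?thesis using pq by (simp add: sum.distrib)
    qed
    have left: "(?E * C) $$ (i, q) = C $$ (i, q) + (if i = p then C $$ (q, q) else 0)" if "i < n" for i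
    proof -
      have "(?E * C) $$ (i, q) = (\<Sum>t<n. ?E $$ (i, t) * C $$ (t, q))"
        using C that pq by (intro mult_mat_entry) auto
      also have "\<dots> = (\<Sum>t<n. (if t = i then C $$ (i, q) else 0) + (if t = q then (if i = p then C $$ (q, q) else 0) else 0))"
        using pq that by (intro sum.cong) auto
      finally show ?thesis using pq that by (simp add: sum.distrib)
    qed
    have "C $$ (i, q) + C $$ (i, p) = C $$ (i, q) + (if i = p then C $$ (q, q) else 0)" if "i < n" for i
      using left[OF that] right[OF that] by (simp only: CE)
    from this[OF pq(1)] this[OF pq(2)] pq(3) show ?thesis by simp
  qed
  have "C = C $$ (0, 0) \<cdot>\<^sub>m 1\<^sub>m n"
  proof (rule eq_matI)
    fix i j assume "i < dim_row (C $$ (0, 0) \<cdot>\<^sub>m 1\<^sub>m n)" "j < dim_col (C $$ (0, 0) \<cdot>\<^sub>m 1\<^sub>m n)"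
    then have ij: "i < n" "j < n" by auto
    then show "C $$ (i, j) = (C $$ (0, 0) \<cdot>\<^sub>m 1\<^sub>m n) $$ (i, j)"
    proof (cases "i = j")
      case True
      then have "C $$ (i, i) = C $$ (0, 0)" using conjunct1[OF *[of i 0]] ij by (cases "i = 0") blast+
      then show ?thesis using True ij by simp
    next
      case False
      then show ?thesis using conjunct2[OF *[of j i]] ij by simp
    qed
  qed (use C in auto)
  then show ?thesis by blast
qed

lemma jet_mat_add:
  assumes "\<And>i. i < k \<Longrightarrow> X i \<in> carrier_mat n n" "\<And>i. i < k \<Longrightarrow> Y i \<in> carrier_mat n n"
  shows "jet_mat k n X + jet_mat k n Y = jet_mat k n (\<lambda>i. X i + Y i)"
proof (rule eq_matI_blocks)
  fix a b p q :: nat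
  assume *: "a < k" "b < k" "p < n" "q < n"
  note less = block_index_less[OF *(1,3)] block_index_less[OF *(2,4)]
  have "(jet_mat k n X + jet_mat k n Y) $$ (a * n + p, b * n + q) =
          jet_mat k n X $$ (a * n + p, b * n + q) + jet_mat k n Y $$ (a * n + p, b * n + q)"
    using less by (intro index_add_mat(1)) (auto simp: jet_mat_def)
  then show "(jet_mat k n X + jet_mat k n Y) $$ (a * n + p, b * n + q) =
      jet_mat k n (\<lambda>i. X i + Y i) $$ (a * n + p, b * n + q)"
    using * assms[of "b - a"] by (simp add: jet_mat_block distrib_left less_imp_diff_less)
qed auto

text \<open>The two test elements are \<open>1 + N\<close>, which shows that \<open>M\<close> itself commutes with \<open>N\<close>, and the constant
  jets \<open>(Z, 0, \<dots>, 0)\<close>, which multiply every entry of a jet by \<open>Z\<close>.\<close>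

lemma commutes_centralizer_imp_scalar_blocks:
  assumes k: "k > 0" and M: "M \<in> carrier_mat (k * n) (k * n)"
    and comm: "\<And>U. U \<in> GL (k * n) \<Longrightarrow> U * nilp_mat k n = nilp_mat k n * U \<Longrightarrow> U * M = M * U"
  shows "\<exists>a. M = jet_mat k n (\<lambda>i. a i \<cdot>\<^sub>m 1\<^sub>m n)"
proof -
  let ?N = "nilp_mat k n"
  have N: "?N \<in> carrier_mat (k * n) (k * n)" by (simp add: nilp_mat_def)
  have comm': "jet_mat k n X * M = M * jet_mat k n X"
    if "\<And>i. X i \<in> carrier_mat n n" "invertible_mat (X 0)" for X
    using that k by (intro comm jet_mat_commutes_nilp) (auto simp: jet_mat_GL_iff)
  have inv1: "invertible_mat (1\<^sub>m n :: real mat)" using one_GL[of n] by (simp add: GL_def)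
  have "M * ?N = ?N * M"
  proof -
    let ?X = "\<lambda>i. jet_monom n 0 (1\<^sub>m n) i + jet_monom n 1 (1\<^sub>m n) i"
    have sum: "1\<^sub>m (k * n) + ?N = jet_mat k n ?X"
      unfolding one_eq_jet_mat nilp_mat_eq_jet_mat by (intro jet_mat_add) (auto simp: jet_monom_def)
    have "?X 0 = 1\<^sub>m n" by (simp add: jet_monom_def)
    then have "(1\<^sub>m (k * n) + ?N) * M = M * (1\<^sub>m (k * n) + ?N)"
      unfolding sum using inv1 by (intro comm') (auto simp: jet_monom_def)
    then have eq: "M + ?N * M = M + M * ?N"
      using M N add_mult_distrib_mat[of "1\<^sub>m (k * n)" "k * n" "k * n" ?N M "k * n"]
        mult_add_distrib_mat[of M "k * n" "k * n" "1\<^sub>m (k * n)" "k * n" ?N] by simp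
    show ?thesis
    proof (rule eq_matI)
      fix i j assume ij: "i < dim_row (?N * M)" "j < dim_col (?N * M)"
      then have "(M + ?N * M) $$ (i, j) = M $$ (i, j) + (?N * M) $$ (i, j)"
        "(M + M * ?N) $$ (i, j) = M $$ (i, j) + (M * ?N) $$ (i, j)"
        using M N by (auto simp del: index_mult_mat(1))
      then show "(M * ?N) $$ (i, j) = (?N * M) $$ (i, j)" using eq by simp
    qed (use M N in auto)
  qed
  then obtain X where X: "\<And>i. X i \<in> carrier_mat n n" "M = jet_mat k n X"
    using commutes_nilp_imp_jet_mat[OF M] by metis
  have "\<exists>c. X i = c \<cdot>\<^sub>m 1\<^sub>m n" if i: "i < k" for i
  proof (rule commutes_GL_imp_scalar[OF X(1)])
    fix Z assume Z: "Z \<in> GL n"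
    let ?Z = "jet_monom n 0 Z"
    have Zc: "?Z i \<in> carrier_mat n n" for i using GL_carrier[OF Z] by (simp add: jet_monom_def)
    have "jet_mat k n ?Z * M = M * jet_mat k n ?Z"
      using Z Zc by (intro comm') (auto simp: jet_monom_def GL_def)
    then have prod: "jet_mat k n (leibniz n n ?Z X) = jet_mat k n (leibniz n n X ?Z)"
      using jet_mat_mult[of k X n ?Z] jet_mat_mult[of k ?Z n X] X Zc by simp
    have left: "leibniz n n ?Z X i = 1 \<cdot>\<^sub>m (Z * X i)" and right: "leibniz n n X ?Z i = 1 \<cdot>\<^sub>m (X i * Z)"
      using leibniz_monom_left[OF X(1) GL_carrier[OF Z], where m = i and j = 0]
        leibniz_monom_right[OF X(1) GL_carrier[OF Z], where m = i and j = 0] by auto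
    show "X i * Z = Z * X i"
    proof (rule eq_matI)
      fix p q assume "p < dim_row (Z * X i)" "q < dim_col (Z * X i)"
      then have pq: "p < n" "q < n" using X(1)[of i] GL_carrier[OF Z] by auto
      have "leibniz n n ?Z X i $$ (p, q) = leibniz n n X ?Z i $$ (p, q)"
        using jet_mat_block[of 0 k i p n q "leibniz n n ?Z X"]
          jet_mat_block[of 0 k i p n q "leibniz n n X ?Z"] prod k i pq by simp
      then show "(X i * Z) $$ (p, q) = (Z * X i) $$ (p, q)"
        unfolding left right using X(1)[of i] GL_carrier[OF Z] pq by (simp del: index_mult_mat(1))
    qed (use X(1)[of i] GL_carrier[OF Z] in auto)
  qed
  then have "\<forall>i. \<exists>c. i < k \<longrightarrow> X i = c \<cdot>\<^sub>m 1\<^sub>m n" by blast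
  from choice[OF this] obtain a where a: "\<forall>i. i < k \<longrightarrow> X i = a i \<cdot>\<^sub>m 1\<^sub>m n" ..
  have "M = jet_mat k n (\<lambda>i. a i \<cdot>\<^sub>m 1\<^sub>m n)" unfolding X(2) using a by (intro jet_mat_cong) simp
  then show ?thesis by blast
qed

section \<open>Frame jets as invertible matrices\<close>

lemma nilp_mat_carrier [simp]: "nilp_mat k n \<in> carrier_mat (k * n) (k * n)"
  by (simp add: nilp_mat_def)

lemma frame_mat_carrier [simp]: "frame_mat k n A \<in> carrier_mat (k * n) (k * n)"
  by (simp add: frame_mat_def)

lemma frame_mat_entry:
  assumes "i < k * n" "b < k" "q < n"
  shows "frame_mat k n A $$ (i, b * n + q) = A ! b $$ (i, q)"
  using assms block_index_less[of b k q n] by (simp add: frame_mat_def)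

lemma eq_matI_block_columns:
  assumes "A \<in> carrier_mat r (k * n)" "B \<in> carrier_mat r (k * n)"
    and "\<And>i b q. i < r \<Longrightarrow> b < k \<Longrightarrow> q < n \<Longrightarrow> A $$ (i, b * n + q) = B $$ (i, b * n + q)"
  shows "A = B"
proof (rule eq_matI)
  fix i j assume "i < dim_row B" "j < dim_col B"
  then have i: "i < r" and j: "j < k * n" using assms(2) by auto
  show "A $$ (i, j) = B $$ (i, j)"
    using assms(3)[OF i, of "j div n" "j mod n"] block_index_div_mod[OF j] by simp
qed (use assms in auto)

lemma fanning_frame_jets_iff:
  assumes "k > 0" "r = k - 1"
  shows "A \<in> fanning_frame_jets r k n \<longleftrightarrow>
    length A = k \<and> (\<forall>b<k. A ! b \<in> carrier_mat (k * n) n) \<and> frame_mat k n A \<in> GL (k * n)"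
  using assms by (auto simp: fanning_frame_jets_def GL_def subset_eq all_set_conv_all_nth)

lemma GL_jets_iff:
  assumes "k > 0" "r = k - 1"
  shows "X \<in> GL_jets r n \<longleftrightarrow>
    length X = k \<and> (\<forall>i<k. X ! i \<in> carrier_mat n n) \<and> invertible_mat (X ! 0)"
  using assms by (auto simp: GL_jets_def subset_eq all_set_conv_all_nth)

lemma frame_mat_inj:
  assumes "k > 0" "A \<in> fanning_frame_jets (k - 1) k n" "B \<in> fanning_frame_jets (k - 1) k n"
    and eq: "frame_mat k n A = frame_mat k n B"
  shows "A = B"
proof (rule nth_equalityI)
  show "length A = length B" using assms by (simp add: fanning_frame_jets_iff)
  fix b assume "b < length A"
  then have b: "b < k" "A ! b \<in> carrier_mat (k * n) n" "B ! b \<in> carrier_mat (k * n) n"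
    using assms by (simp_all add: fanning_frame_jets_iff)
  show "A ! b = B ! b"
  proof (rule eq_matI)
    fix i q assume "i < dim_row (B ! b)" "q < dim_col (B ! b)"
    then show "A ! b $$ (i, q) = B ! b $$ (i, q)"
      using b eq frame_mat_entry[of i k n b q A] frame_mat_entry[of i k n b q B] by simp
  qed (use b in auto)
qed

lemma frame_mat_surj:
  assumes "k > 0" "C \<in> GL (k * n)"
  obtains A where "A \<in> fanning_frame_jets (k - 1) k n" "frame_mat k n A = C"
proof -
  let ?A = "map (\<lambda>b. mat (k * n) n (\<lambda>(i, q). C $$ (i, b * n + q))) [0..<k]"
  have C: "C \<in> carrier_mat (k * n) (k * n)" using assms(2) by (rule GL_carrier)
  have "frame_mat k n ?A = C"
    using C by (intro eq_matI_block_columns[of _ "k * n" k n]) (auto simp: frame_mat_entry)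
  moreover from this have "?A \<in> fanning_frame_jets (k - 1) k n"
    using assms by (simp add: fanning_frame_jets_iff)
  ultimately show ?thesis using that by blast
qed

lemma frame_mat_GL_act:
  assumes k: "k > 0" and A: "A \<in> fanning_frame_jets (k - 1) k n" and T: "T \<in> carrier_mat (k * n) (k * n)"
  shows "frame_mat k n (GL_act_frame T A) = T * frame_mat k n A"
proof (rule eq_matI_block_columns[of _ "k * n" k n])
  fix i b q assume *: "i < k * n" "b < k" "q < n"
  have Ab: "b < length A" "A ! b \<in> carrier_mat (k * n) n"
    using A k * by (auto simp: fanning_frame_jets_iff)
  have "frame_mat k n (GL_act_frame T A) $$ (i, b * n + q) = (T * A ! b) $$ (i, q)"
    using * Ab by (simp add: frame_mat_entry GL_act_frame_def del: index_mult_mat(1))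
  also have "\<dots> = (\<Sum>t<k * n. T $$ (i, t) * frame_mat k n A $$ (t, b * n + q))"
    using * Ab T by (subst mult_mat_entry[of _ "k * n" "k * n"]) (auto simp: frame_mat_entry)
  also have "\<dots> = (T * frame_mat k n A) $$ (i, b * n + q)"
    using * by (intro mult_mat_entry[OF T frame_mat_carrier, symmetric]) (auto simp: block_index_less)
  finally show "frame_mat k n (GL_act_frame T A) $$ (i, b * n + q) = (T * frame_mat k n A) $$ (i, b * n + q)" .
qed (use mult_carrier_mat[OF T frame_mat_carrier] in auto)

lemma GL_act_frame_jets:
  assumes k: "k > 0" and A: "A \<in> fanning_frame_jets (k - 1) k n" and T: "T \<in> GL (k * n)"
  shows "GL_act_frame T A \<in> fanning_frame_jets (k - 1) k n"
  using assms frame_mat_GL_act[OF k A GL_carrier[OF T]] mult_GL[OF T] GL_carrier[OF T]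
  by (auto simp: fanning_frame_jets_iff GL_act_frame_def intro: mult_carrier_mat)

lemma jet_act_nth:
  assumes "m \<le> r"
  shows "jet_act r k n A X ! m = leibniz (k * n) n ((!) A) ((!) X) m"
  using assms by (simp add: jet_act_def leibniz_def del: upt_Suc)

lemma jet_act_frame_jets:
  assumes k: "k > 0" and GL: "frame_mat k n (jet_act (k - 1) k n A X) \<in> GL (k * n)"
  shows "jet_act (k - 1) k n A X \<in> fanning_frame_jets (k - 1) k n"
proof -
  have "length (jet_act (k - 1) k n A X) = k" using k by (simp add: jet_act_def)
  moreover have "jet_act (k - 1) k n A X ! b \<in> carrier_mat (k * n) n" if "b < k" for b
    using that by (subst jet_act_nth) auto
  ultimately show ?thesis using k GL by (simp add: fanning_frame_jets_iff)
qed

lemma frame_mat_jet_act: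
  assumes k: "k > 0" and A: "A \<in> fanning_frame_jets (k - 1) k n" and X: "X \<in> GL_jets (k - 1) n"
  shows "frame_mat k n (jet_act (k - 1) k n A X) = frame_mat k n A * jet_mat k n ((!) X)"
proof (rule eq_matI_block_columns[of _ "k * n" k n])
  fix i b q assume *: "i < k * n" "b < k" "q < n"
  have Ac: "A ! j \<in> carrier_mat (k * n) n" and Xc: "X ! j \<in> carrier_mat n n" if "j < k" for j
    using A X k that by (simp_all add: fanning_frame_jets_iff GL_jets_iff)
  have "frame_mat k n (jet_act (k - 1) k n A X) $$ (i, b * n + q) = leibniz (k * n) n ((!) A) ((!) X) b $$ (i, q)"
    using * k by (simp add: frame_mat_entry jet_act_nth less_eq_Suc_le)
  also have "\<dots> = (\<Sum>j\<le>b. real (b choose j) * (\<Sum>s<n. A ! (b - j) $$ (i, s) * X ! j $$ (s, q)))"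
    using * Ac Xc by (intro leibniz_entry) auto
  also have "\<dots> = (frame_mat k n A * jet_mat k n ((!) X)) $$ (i, b * n + q)"
    using * by (subst mult_jet_mat_block) (auto simp: frame_mat_entry less_imp_diff_less intro!: sum.cong)
  finally show "frame_mat k n (jet_act (k - 1) k n A X) $$ (i, b * n + q) =
      (frame_mat k n A * jet_mat k n ((!) X)) $$ (i, b * n + q)" .
qed (use mult_carrier_mat[OF frame_mat_carrier jet_mat_carrier] in auto)

section \<open>Curve jets as fibres of the fundamental endomorphism\<close>

text \<open>Conjugating both sides back by \<open>C\<close> turns the left hand side into \<open>U N U\<inverse> = N\<close>. With frame matrices
  for \<open>C\<close> and \<open>D\<close> this compares fundamental endomorphisms.\<close>

lemma fund_endo_eq_iff:
  assumes C: "C \<in> GL (k * n)" and D: "D \<in> GL (k * n)"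
  defines "U \<equiv> minv C * D"
  shows "D * nilp_mat k n * minv D = C * nilp_mat k n * minv C \<longleftrightarrow> U * nilp_mat k n = nilp_mat k n * U"
proof -
  let ?N = "nilp_mat k n"
  have U: "U \<in> GL (k * n)" unfolding U_def by (intro mult_GL minv_GL C D)
  have D_eq: "D = C * U"
    using GL_carrier[OF C] GL_carrier[OF D] minv_carrier[OF C] mult_minv[OF C]
    by (simp add: U_def assoc_mult_mat[symmetric, of _ "k*n" "k*n" _ "k*n" _ "k*n"])
  have UNU: "U * ?N * minv U \<in> carrier_mat (k * n) (k * n)"
    using GL_carrier[OF U] minv_carrier[OF U] by (meson mult_carrier_mat nilp_mat_carrier)
  have "D * ?N * minv D = C * (U * ?N * minv U) * minv C"
    unfolding D_eq by (rule conj_mult[OF C U nilp_mat_carrier])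
  moreover have "C * (U * ?N * minv U) * minv C = C * ?N * minv C \<longleftrightarrow> U * ?N * minv U = ?N"
    using conj_minv[OF C UNU] conj_minv[OF C nilp_mat_carrier] by metis
  ultimately show ?thesis using conj_eq_iff_commute[OF U nilp_mat_carrier] by simp
qed

text \<open>By definition the class of \<open>A\<close> consists of the frames with matrix \<open>\<^bold>A U(X)\<close>, and the invertible
  \<open>U(X)\<close> form the centralizer of \<open>N\<close>.\<close>

lemma jet_class_eq_fibre:
  assumes k: "k > 0" and A: "A \<in> fanning_frame_jets (k - 1) k n"
  shows "jet_class (k - 1) k n A = {B \<in> fanning_frame_jets (k - 1) k n. fund_endo k n B = fund_endo k n A}"
proof (intro equalityI subsetI)
  let ?C = "frame_mat k n A"
  have C: "?C \<in> GL (k * n)" using A k by (simp add: fanning_frame_jets_iff)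
  let ?R = "{B \<in> fanning_frame_jets (k - 1) k n. fund_endo k n B = fund_endo k n A}"
  show "B \<in> ?R" if "B \<in> jet_class (k - 1) k n A" for B
  proof -
    from that obtain X where X: "X \<in> GL_jets (k - 1) n" and B: "B = jet_act (k - 1) k n A X"
      by (auto simp: jet_class_def jet_rel_def)
    let ?U = "jet_mat k n ((!) X)"
    have Xc: "\<And>i. i < k \<Longrightarrow> X ! i \<in> carrier_mat n n" using X k by (simp add: GL_jets_iff)
    have U: "?U \<in> GL (k * n)" using X k by (subst jet_mat_GL_iff) (auto simp: GL_jets_iff)
    have D: "frame_mat k n B = ?C * ?U" unfolding B by (rule frame_mat_jet_act[OF k A X])
    have "minv ?C * frame_mat k n B = ?U"
      using GL_carrier[OF C] minv_carrier[OF C] minv_mult[OF C]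
      by (simp add: D left_mult_one_mat[OF jet_mat_carrier] assoc_mult_mat[symmetric, of _ "k*n" "k*n" _ "k*n" _ "k*n"])
    moreover have "?U * nilp_mat k n = nilp_mat k n * ?U" by (rule jet_mat_commutes_nilp[OF Xc])
    moreover have DGL: "frame_mat k n B \<in> GL (k * n)" unfolding D by (rule mult_GL[OF C U])
    ultimately have "fund_endo k n B = fund_endo k n A"
      unfolding fund_endo_def by (simp add: fund_endo_eq_iff[OF C DGL])
    moreover have "B \<in> fanning_frame_jets (k - 1) k n"
      using DGL unfolding B by (rule jet_act_frame_jets[OF k])
    ultimately show ?thesis by simp
  qed
  show "B \<in> jet_class (k - 1) k n A" if "B \<in> ?R" for B
  proof -
    from that have B: "B \<in> fanning_frame_jets (k - 1) k n" and eq: "fund_endo k n B = fund_endo k n A" by auto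
    have D: "frame_mat k n B \<in> GL (k * n)" using B k by (simp add: fanning_frame_jets_iff)
    let ?U = "minv ?C * frame_mat k n B"
    have U: "?U \<in> GL (k * n)" by (intro mult_GL minv_GL C D)
    have "?U * nilp_mat k n = nilp_mat k n * ?U"
      using eq fund_endo_eq_iff[OF C D] by (simp add: fund_endo_def)
    then obtain Y where Y: "\<And>i. Y i \<in> carrier_mat n n" "?U = jet_mat k n Y"
      using commutes_nilp_imp_jet_mat[OF GL_carrier[OF U]] by blast
    \<comment> \<open>The jet carrying \<open>A\<close> to \<open>B\<close> is read off from \<open>minv \<^bold>A * \<^bold>B\<close>.\<close>
    let ?X = "map Y [0..<k]"
    have UX: "jet_mat k n ((!) ?X) = ?U" unfolding Y(2) by (rule jet_mat_cong) simp
    have "invertible_mat (Y 0)" using U Y k jet_mat_GL_iff[of k Y n] by simp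
    then have X: "?X \<in> GL_jets (k - 1) n" using Y k by (simp add: GL_jets_iff)
    have "frame_mat k n (jet_act (k - 1) k n A ?X) = ?C * ?U"
      using frame_mat_jet_act[OF k A X] by (simp only: UX)
    also have "\<dots> = frame_mat k n B"
      using GL_carrier[OF C] minv_carrier[OF C] mult_minv[OF C]
      by (simp add: left_mult_one_mat[OF frame_mat_carrier] assoc_mult_mat[symmetric, of _ "k*n" "k*n" _ "k*n" _ "k*n"])
    finally have frame: "frame_mat k n (jet_act (k - 1) k n A ?X) = frame_mat k n B" .
    have "jet_act (k - 1) k n A ?X \<in> fanning_frame_jets (k - 1) k n"
      using D unfolding frame[symmetric] by (rule jet_act_frame_jets[OF k])
    then have "B = jet_act (k - 1) k n A ?X" using frame_mat_inj[OF k _ B frame] by simp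
    then show ?thesis using A X by (auto simp: jet_class_def jet_rel_def)
  qed
qed

section \<open>Polynomials in the fundamental endomorphism\<close>

lemma mult_mat_sum:
  assumes M: "\<And>i. i \<in> I \<Longrightarrow> M i \<in> carrier_mat d d" and C: "C \<in> carrier_mat d d" and D: "D \<in> carrier_mat d d"
  shows "C * mat_sum d d M I * D = mat_sum d d (\<lambda>i. C * M i * D) I"
proof (rule eq_matI)
  have S: "mat_sum d d M I \<in> carrier_mat d d" by (simp add: mat_sum_def)
  fix p q assume "p < dim_row (mat_sum d d (\<lambda>i. C * M i * D) I)" "q < dim_col (mat_sum d d (\<lambda>i. C * M i * D) I)"
  then have pq: "p < d" "q < d" by (auto simp: mat_sum_def)
  have triple: "(C * M' * D) $$ (p, q) = (\<Sum>t<d. (\<Sum>s<d. C $$ (p, s) * M' $$ (s, t)) * D $$ (t, q))"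
    if "M' \<in> carrier_mat d d" for M'
  proof -
    have "(C * M' * D) $$ (p, q) = (\<Sum>t<d. (C * M') $$ (p, t) * D $$ (t, q))"
      using pq that C D by (intro mult_mat_entry) auto
    also have "\<dots> = (\<Sum>t<d. (\<Sum>s<d. C $$ (p, s) * M' $$ (s, t)) * D $$ (t, q))"
    proof (intro sum.cong refl)
      fix t assume "t \<in> {..<d}"
      then have "(C * M') $$ (p, t) = (\<Sum>s<d. C $$ (p, s) * M' $$ (s, t))"
        using pq by (intro mult_mat_entry[OF C that]) auto
      then show "(C * M') $$ (p, t) * D $$ (t, q) = (\<Sum>s<d. C $$ (p, s) * M' $$ (s, t)) * D $$ (t, q)" by simp
    qed
    finally show ?thesis .
  qed
  have "(C * mat_sum d d M I * D) $$ (p, q) =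
          (\<Sum>t<d. (\<Sum>s<d. C $$ (p, s) * (\<Sum>i\<in>I. M i $$ (s, t))) * D $$ (t, q))"
    using triple[OF S] by (simp add: mat_sum_def)
  also have "\<dots> = (\<Sum>t<d. \<Sum>s<d. \<Sum>i\<in>I. C $$ (p, s) * M i $$ (s, t) * D $$ (t, q))"
    by (simp add: sum_distrib_left sum_distrib_right)
  also have "\<dots> = (\<Sum>t<d. \<Sum>i\<in>I. \<Sum>s<d. C $$ (p, s) * M i $$ (s, t) * D $$ (t, q))"
    by (intro sum.cong refl sum.swap)
  also have "\<dots> = (\<Sum>i\<in>I. \<Sum>t<d. \<Sum>s<d. C $$ (p, s) * M i $$ (s, t) * D $$ (t, q))"
    by (rule sum.swap)
  also have "\<dots> = (\<Sum>i\<in>I. (C * M i * D) $$ (p, q))"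
    using M by (intro sum.cong refl) (simp add: triple sum_distrib_right)
  finally show "(C * mat_sum d d M I * D) $$ (p, q) = mat_sum d d (\<lambda>i. C * M i * D) I $$ (p, q)"
    using pq by (simp add: mat_sum_def)
qed (use C D in \<open>auto simp: mat_sum_def\<close>)

lemma conj_pow:
  assumes C: "C \<in> GL d" and M: "M \<in> carrier_mat d d"
  shows "(C * M * minv C) ^\<^sub>m i = C * M ^\<^sub>m i * minv C"
proof (induction i)
  case 0
  then show ?case using GL_carrier[OF C] M mult_minv[OF C] by simp
next
  case (Suc i)
  note [simp] = GL_carrier[OF C] minv_carrier[OF C] M pow_carrier_mat[OF M]
  have "(C * M ^\<^sub>m i * minv C) * (C * M * minv C) = C * M ^\<^sub>m i * (minv C * C) * M * minv C"
    by (simp add: assoc_mult_mat[of _ d d _ d _ d] mult_carrier_mat[of _ d d _ d])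
  also have "\<dots> = C * (M ^\<^sub>m i * M) * minv C"
    by (simp add: minv_mult[OF C] right_mult_one_mat[of _ d d] assoc_mult_mat[of _ d d _ d _ d] mult_carrier_mat[of _ d d _ d])
  finally show ?case by (simp add: Suc.IH)
qed

text \<open>Block \<open>(b, c)\<close> of \<open>N\<^bsup>i\<^esup> / i!\<close> is \<open>(c choose b)\<close> if \<open>c - b = i\<close> and zero otherwise, so that each
  block receives a contribution from one power only.\<close>

lemma mat_sum_nilp_pow:
  assumes k: "k > 0"
  shows "mat_sum (k * n) (k * n) (\<lambda>i. (a i / fact i) \<cdot>\<^sub>m nilp_mat k n ^\<^sub>m i) {0..k - 1} =
           jet_mat k n (\<lambda>i. a i \<cdot>\<^sub>m 1\<^sub>m n)"
proof (rule eq_matI_blocks)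
  fix b c p q :: nat
  assume *: "b < k" "c < k" "p < n" "q < n"
  note less = block_index_less[OF *(1,3)] block_index_less[OF *(2,4)]
  let ?e = "real (c choose b) * (a (c - b) * 1\<^sub>m n $$ (p, q))"
  have "mat_sum (k * n) (k * n) (\<lambda>i. (a i / fact i) \<cdot>\<^sub>m nilp_mat k n ^\<^sub>m i) {0..k - 1} $$ (b * n + p, c * n + q) =
      (\<Sum>i\<in>{0..k - 1}. ((a i / fact i) \<cdot>\<^sub>m nilp_mat k n ^\<^sub>m i) $$ (b * n + p, c * n + q))"
    using less by (simp add: mat_sum_def)
  also have "\<dots> = (\<Sum>i\<in>{0..k - 1}. if i = c - b then ?e else 0)"
  proof (intro sum.cong refl)
    fix i
    have "((a i / fact i) \<cdot>\<^sub>m nilp_mat k n ^\<^sub>m i) $$ (b * n + p, c * n + q) =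
            a i / fact i * (real (c choose b) * jet_monom n i (fact i \<cdot>\<^sub>m 1\<^sub>m n) (c - b) $$ (p, q))"
      unfolding nilp_mat_pow using less * by (subst index_smult_mat) (auto simp: jet_mat_block jet_mat_def[of k n] simp del: jet_mat_def)
    then show "((a i / fact i) \<cdot>\<^sub>m nilp_mat k n ^\<^sub>m i) $$ (b * n + p, c * n + q) = (if i = c - b then ?e else 0)"
      using * by (simp add: jet_monom_def)
  qed
  also have "\<dots> = ?e"
  proof -
    have "c - b \<in> {0..k - 1}" using * by auto
    then show ?thesis by simp
  qed
  also have "\<dots> = jet_mat k n (\<lambda>i. a i \<cdot>\<^sub>m 1\<^sub>m n) $$ (b * n + p, c * n + q)"
    using * by (simp add: jet_mat_block)
  finally show "mat_sum (k * n) (k * n) (\<lambda>i. (a i / fact i) \<cdot>\<^sub>m nilp_mat k n ^\<^sub>m i) {0..k - 1} $$ (b * n + p, c * n + q) =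
      jet_mat k n (\<lambda>i. a i \<cdot>\<^sub>m 1\<^sub>m n) $$ (b * n + p, c * n + q)" .
qed (auto simp: mat_sum_def)

lemma fund_poly_eq_conj:
  assumes k: "k > 0" and A: "A \<in> fanning_frame_jets (k - 1) k n"
  shows "fund_poly k n a A = frame_mat k n A * jet_mat k n (\<lambda>i. a i \<cdot>\<^sub>m 1\<^sub>m n) * minv (frame_mat k n A)"
proof -
  let ?C = "frame_mat k n A" and ?N = "nilp_mat k n" and ?d = "k * n"
  have C: "?C \<in> GL ?d" using A k by (simp add: fanning_frame_jets_iff)
  have "(a i / fact i) \<cdot>\<^sub>m fund_endo k n A ^\<^sub>m i = ?C * ((a i / fact i) \<cdot>\<^sub>m ?N ^\<^sub>m i) * minv ?C" for i
  proof -
    note [simp] = GL_carrier[OF C] minv_carrier[OF C] pow_carrier_mat[OF nilp_mat_carrier]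
    show ?thesis
      by (simp add: fund_endo_def conj_pow[OF C] mult_smult_distrib[of _ ?d ?d _ ?d]
          mult_smult_assoc_mat[of _ ?d ?d _ ?d] mult_carrier_mat[of _ ?d ?d _ ?d])
  qed
  then have "fund_poly k n a A = mat_sum ?d ?d (\<lambda>i. ?C * ((a i / fact i) \<cdot>\<^sub>m ?N ^\<^sub>m i) * minv ?C) {0..k - 1}"
    by (simp add: fund_poly_def)
  also have "\<dots> = ?C * mat_sum ?d ?d (\<lambda>i. (a i / fact i) \<cdot>\<^sub>m ?N ^\<^sub>m i) {0..k - 1} * minv ?C"
    using GL_carrier[OF C] minv_carrier[OF C]
    by (intro mult_mat_sum[symmetric]) (auto intro!: smult_carrier_mat pow_carrier_mat)
  finally show ?thesis unfolding mat_sum_nilp_pow[OF k] .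
qed

section \<open>Equivariant maps\<close>

lemma GL_act_frame_minv:
  assumes T: "T \<in> GL (k * n)" and A: "\<And>b. b < length A \<Longrightarrow> A ! b \<in> carrier_mat (k * n) n"
  shows "GL_act_frame T (GL_act_frame (minv T) A) = A"
proof (rule nth_equalityI)
  show "length (GL_act_frame T (GL_act_frame (minv T) A)) = length A" by (simp add: GL_act_frame_def)
  fix b assume "b < length (GL_act_frame T (GL_act_frame (minv T) A))"
  then have b: "b < length A" by (simp add: GL_act_frame_def)
  have "T * (minv T * A ! b) = T * minv T * A ! b"
    using GL_carrier[OF T] minv_carrier[OF T] A[OF b] by (intro assoc_mult_mat[symmetric])
  then show "GL_act_frame T (GL_act_frame (minv T) A) ! b = A ! b"
    using b A[OF b] by (simp add: GL_act_frame_def mult_minv[OF T])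
qed

lemma fund_endo_GL_act:
  assumes k: "k > 0" and A: "A \<in> fanning_frame_jets (k - 1) k n" and T: "T \<in> GL (k * n)"
  shows "fund_endo k n (GL_act_frame T A) = T * fund_endo k n A * minv T"
proof -
  have C: "frame_mat k n A \<in> GL (k * n)" using A k by (simp add: fanning_frame_jets_iff)
  show ?thesis
    unfolding fund_endo_def frame_mat_GL_act[OF k A GL_carrier[OF T]]
    by (rule conj_mult[OF T C nilp_mat_carrier])
qed

text \<open>Since \<open>F\<close> is equivariant, \<open>T\<close> maps its fibres onto fibres; the inverse of \<open>T\<close> gives surjectivity.\<close>

lemma GL_act_jet_class:
  assumes k: "k > 0" and A: "A \<in> fanning_frame_jets (k - 1) k n" and T: "T \<in> GL (k * n)"
  shows "GL_act_curve T (jet_class (k - 1) k n A) = jet_class (k - 1) k n (GL_act_frame T A)"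
proof -
  let ?J = "fanning_frame_jets (k - 1) k n"
  have TA: "GL_act_frame T A \<in> ?J" by (rule GL_act_frame_jets[OF k A T])
  have Fc: "fund_endo k n A \<in> carrier_mat (k * n) (k * n)"
    unfolding fund_endo_def using A k
    by (intro mult_carrier_mat[of _ "k*n" "k*n"] minv_carrier) (auto simp: fanning_frame_jets_iff)
  show ?thesis
    unfolding GL_act_curve_def jet_class_eq_fibre[OF k A] jet_class_eq_fibre[OF k TA]
  proof (intro equalityI subsetI)
    fix B assume "B \<in> GL_act_frame T ` {B \<in> ?J. fund_endo k n B = fund_endo k n A}"
    then obtain B' where B': "B' \<in> ?J" "fund_endo k n B' = fund_endo k n A" "B = GL_act_frame T B'" by auto
    then show "B \<in> {B \<in> ?J. fund_endo k n B = fund_endo k n (GL_act_frame T A)}"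
      using GL_act_frame_jets[OF k B'(1) T] fund_endo_GL_act[OF k B'(1) T] fund_endo_GL_act[OF k A T] by simp
  next
    fix B assume "B \<in> {B \<in> ?J. fund_endo k n B = fund_endo k n (GL_act_frame T A)}"
    then have B: "B \<in> ?J" and F: "fund_endo k n B = T * fund_endo k n A * minv T"
      using fund_endo_GL_act[OF k A T] by auto
    let ?B' = "GL_act_frame (minv T) B"
    have "fund_endo k n ?B' = fund_endo k n A"
      using fund_endo_GL_act[OF k B minv_GL[OF T]] conj_minv[OF T Fc] by (simp add: F minv_minv[OF T])
    moreover have "?B' \<in> ?J" by (rule GL_act_frame_jets[OF k B minv_GL[OF T]])
    moreover have "B = GL_act_frame T ?B'"
      using B k by (intro GL_act_frame_minv[OF T, symmetric]) (auto simp: fanning_frame_jets_iff)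
    ultimately show "B \<in> GL_act_frame T ` {B \<in> ?J. fund_endo k n B = fund_endo k n A}" by blast
  qed
qed

lemma fanning_curve_jets_eq: "fanning_curve_jets r k n = jet_class r k n ` fanning_frame_jets r k n"
  by (auto simp: fanning_curve_jets_def jet_class_def quotient_def)

lemma fund_poly_GL_act:
  assumes k: "k > 0" and A: "A \<in> fanning_frame_jets (k - 1) k n" and T: "T \<in> GL (k * n)"
  shows "fund_poly k n a (GL_act_frame T A) = T * fund_poly k n a A * minv T"
proof -
  have C: "frame_mat k n A \<in> GL (k * n)" using A k by (simp add: fanning_frame_jets_iff)
  show ?thesis
    unfolding fund_poly_eq_conj[OF k A] fund_poly_eq_conj[OF k GL_act_frame_jets[OF k A T]]
      frame_mat_GL_act[OF k A GL_carrier[OF T]]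
    by (rule conj_mult[OF T C jet_mat_carrier])
qed

text \<open>The choice of a representative does not matter because \<^const>\<open>fund_poly\<close> depends on the frame only
  through its fundamental endomorphism, which is constant on classes.\<close>

lemma fund_poly_descends:
  assumes k: "k > 0"
  shows "\<exists>f \<in> fanning_curve_jets (k - 1) k n \<rightarrow> carrier_mat (k * n) (k * n).
           \<forall>A \<in> fanning_frame_jets (k - 1) k n. f (jet_class (k - 1) k n A) = fund_poly k n a A"
proof (intro bexI ballI)
  let ?f = "\<lambda>c. fund_poly k n a (SOME B. B \<in> c)"
  show "?f \<in> fanning_curve_jets (k - 1) k n \<rightarrow> carrier_mat (k * n) (k * n)"
    by (auto simp: fund_poly_def mat_sum_def)
  fix A assume A: "A \<in> fanning_frame_jets (k - 1) k n"
  have "A \<in> jet_class (k - 1) k n A" unfolding jet_class_eq_fibre[OF k A] using A by simp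
  then have "(SOME B. B \<in> jet_class (k - 1) k n A) \<in> jet_class (k - 1) k n A" by (rule someI)
  then have "fund_endo k n (SOME B. B \<in> jet_class (k - 1) k n A) = fund_endo k n A"
    by (subst (asm) (2) jet_class_eq_fibre[OF k A]) simp
  then show "?f (jet_class (k - 1) k n A) = fund_poly k n a A" by (simp add: fund_poly_def)
qed

text \<open>The action is transitive, so \<open>f\<close> is determined by its value \<open>M\<close> at the class of the frame \<open>E\<close> whose
  matrix is the identity. The centralizer of \<open>N\<close> fixes that class, because its fundamental
  endomorphism is \<open>N\<close>, and so fixes \<open>M\<close>.\<close>

lemma equivariant_imp_fund_poly:
  assumes k: "k > 0" and f: "f \<in> fanning_curve_jets (k - 1) k n \<rightarrow> carrier_mat (k * n) (k * n)"
    and equiv: "GL_equivariant (k - 1) k n f"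
  shows "\<exists>a. \<forall>A \<in> fanning_frame_jets (k - 1) k n. f (jet_class (k - 1) k n A) = fund_poly k n a A"
proof -
  let ?J = "fanning_frame_jets (k - 1) k n" and ?cl = "jet_class (k - 1) k n" and ?d = "k * n"
  obtain E where E: "E \<in> ?J" "frame_mat k n E = 1\<^sub>m ?d"
    using frame_mat_surj[OF k one_GL] by blast
  define M where "M = f (?cl E)"
  have M: "M \<in> carrier_mat ?d ?d" using f E(1) by (auto simp: M_def fanning_curve_jets_eq)
  have f_GL: "f (?cl (GL_act_frame T E)) = T * M * minv T" if "T \<in> GL ?d" for T
  proof -
    have "f (GL_act_curve T (?cl E)) = T * M * minv T"
      using equiv that E(1) by (auto simp: GL_equivariant_def M_def fanning_curve_jets_eq)
    then show ?thesis unfolding GL_act_jet_class[OF k E(1) that] .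
  qed
  have FE: "fund_endo k n E = nilp_mat k n"
    using left_mult_one_mat[OF nilp_mat_carrier] right_mult_one_mat[OF nilp_mat_carrier]
    by (simp add: fund_endo_def E(2) minv_one)
  have "U * M = M * U" if U: "U \<in> GL ?d" and comm: "U * nilp_mat k n = nilp_mat k n * U" for U
  proof -
    have "fund_endo k n (GL_act_frame U E) = fund_endo k n E"
      using comm conj_eq_iff_commute[OF U nilp_mat_carrier] fund_endo_GL_act[OF k E(1) U] by (simp add: FE)
    then have "?cl (GL_act_frame U E) = ?cl E"
      unfolding jet_class_eq_fibre[OF k E(1)] jet_class_eq_fibre[OF k GL_act_frame_jets[OF k E(1) U]] by simp
    then have "U * M * minv U = M" using f_GL[OF U] by (simp add: M_def)
    then show ?thesis using conj_eq_iff_commute[OF U M] by simp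
  qed
  then obtain a where a: "M = jet_mat k n (\<lambda>i. a i \<cdot>\<^sub>m 1\<^sub>m n)" using commutes_centralizer_imp_scalar_blocks[OF k M] by blast
  have "f (?cl A) = fund_poly k n a A" if A: "A \<in> ?J" for A
  proof -
    let ?C = "frame_mat k n A"
    have C: "?C \<in> GL ?d" using A k by (simp add: fanning_frame_jets_iff)
    have "frame_mat k n (GL_act_frame ?C E) = ?C"
      using frame_mat_GL_act[OF k E(1) GL_carrier[OF C]] GL_carrier[OF C] by (simp add: E(2))
    then have "GL_act_frame ?C E = A"
      using frame_mat_inj[OF k GL_act_frame_jets[OF k E(1) C] A] by simp
    then show ?thesis using f_GL[OF C] fund_poly_eq_conj[OF k A] by (simp add: a)
  qed
  then show ?thesis by blast
qed

lemma fund_poly_imp_equivariant: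
  assumes k: "k > 0"
    and f: "\<And>A. A \<in> fanning_frame_jets (k - 1) k n \<Longrightarrow> f (jet_class (k - 1) k n A) = fund_poly k n a A"
  shows "GL_equivariant (k - 1) k n f"
  unfolding GL_equivariant_def fanning_curve_jets_eq
proof (intro ballI, elim imageE)
  fix T c A assume T: "T \<in> GL (k * n)" and A: "A \<in> fanning_frame_jets (k - 1) k n" and c: "c = jet_class (k - 1) k n A"
  show "f (GL_act_curve T c) = T * f c * minv T"
    unfolding c GL_act_jet_class[OF k A T] f[OF A] f[OF GL_act_frame_jets[OF k A T]]
    by (rule fund_poly_GL_act[OF k A T])
qed

theorem theorem4p4:
  fixes n k :: nat
  assumes "n \<ge> 1" and "k \<ge> 2"
  shows "(\<forall>a :: nat \<Rightarrow> real.
            \<exists>f \<in> fanning_curve_jets (k - 1) k n \<rightarrow> carrier_mat (k * n) (k * n).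
              \<forall>A \<in> fanning_frame_jets (k - 1) k n. f (jet_class (k - 1) k n A) = fund_poly k n a A)
       \<and> (\<forall>f \<in> fanning_curve_jets (k - 1) k n \<rightarrow> carrier_mat (k * n) (k * n).
            GL_equivariant (k - 1) k n f \<longleftrightarrow>
              (\<exists>a :: nat \<Rightarrow> real. \<forall>A \<in> fanning_frame_jets (k - 1) k n.
                 f (jet_class (k - 1) k n A) = fund_poly k n a A))"
proof -
  have k: "k > 0" using assms(2) by simp
  show ?thesis
    using fund_poly_descends[OF k] equivariant_imp_fund_poly[OF k] fund_poly_imp_equivariant[OF k] by blast
qed

end
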